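(* Let $1\le k\le n$. Any (randomized) algorithm that, given {\textsc{SAMP}} access and ${\textsc{COND-EVAL}}_k$ access to an unknown distribution $D$ on $[n]$, approximates the support size $|\mathrm{supp}(D)|$ within a multiplicative $6/5$-factor with probability at least $2/3$, must make at least $\Omega(n/k)$ queries.
   Context: For a distribution $D$ on $[n]=\{1,\dots,n\}$ and $S\subseteq[n]$, $D(S)=\sum_{i\in S}D(i)$, and $\mathrm{supp}(D)=\{x:D(x)>0\}$. A {\textsc{SAMP}} oracle returns an independent sample $j\in[n]$ with probability $D(j)$. A ${\textsc{COND-EVAL}}_k$ oracle takes as input any set $S\subseteq[n]$ with $|S|\le k$ (possibly chosen adaptively); if $D(S)>0$ it returns $(j,D(j),D(j)/D(S))$ where $j\in S$ is drawn with probability $D(j)/D(S)$, and if $D(S)=0$ it returns "failure". An estimate $N$ is within a multiplicative $6/5$-factor if $\frac56|\mathrm{supp}(D)|\le N\le\frac65|\mathrm{supp}(D)|$. The guarantee must hold for every distribution $D$ on $[n]$. *)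

theory Defs
  imports "HOL-Probability.Probability"
begin

definition dists_on :: "nat \<Rightarrow> nat pmf set" where
  "dists_on n = {D. set_pmf D \<subseteq> {1..n}}"

text \<open>The answer to a query \<open>S\<close> of the conditional evaluation oracle; \<open>None\<close> is ``failure''.\<close>

definition cond_eval_oracle :: "nat pmf \<Rightarrow> nat set \<Rightarrow> (nat \<times> real \<times> real) option pmf" where
  "cond_eval_oracle D S =
     (if measure_pmf.prob D S > 0
      then map_pmf (\<lambda>j. Some (j, pmf D j, pmf D j / measure_pmf.prob D S)) (cond_pmf D S)
      else return_pmf None)"

text \<open>
  Deterministic adaptive algorithms are decision trees: each node either halts with an estimate
  or makes one oracle query and branches on the answer.
\<close>

datatype det_alg =
    Output real
  | Samp "nat \<Rightarrow> det_alg"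
  | Cond_Eval "nat set" "(nat \<times> real \<times> real) option \<Rightarrow> det_alg"

primrec valid_queries :: "nat \<Rightarrow> nat \<Rightarrow> det_alg \<Rightarrow> bool" where
  "valid_queries n k (Output N) \<longleftrightarrow> True"
| "valid_queries n k (Samp f) \<longleftrightarrow> (\<forall>j. valid_queries n k (f j))"
| "valid_queries n k (Cond_Eval S f) \<longleftrightarrow>
     S \<subseteq> {1..n} \<and> card S \<le> k \<and> (\<forall>r. valid_queries n k (f r))"

text \<open>Joint distribution of the output and of the number of queries (to either oracle).\<close>

primrec run :: "nat pmf \<Rightarrow> det_alg \<Rightarrow> (real \<times> nat) pmf" where
  "run D (Output N) = return_pmf (N, 0)"
| "run D (Samp f) =
     bind_pmf D (\<lambda>j. map_pmf (apsnd Suc) (run D (f j)))"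
| "run D (Cond_Eval S f) =
     bind_pmf (cond_eval_oracle D S) (\<lambda>r. map_pmf (apsnd Suc) (run D (f r)))"

text \<open>
  A randomized algorithm is a probability measure on deterministic ones. Its sigma-algebra is
  arbitrary, so that every probability space of random seeds is covered by push-forward.
\<close>

definition randomized_alg :: "nat \<Rightarrow> nat \<Rightarrow> det_alg measure \<Rightarrow> bool" where
  "randomized_alg n k M \<longleftrightarrow> prob_space M \<and> (\<forall>A\<in>space M. valid_queries n k A)"

definition good_estimate :: "nat pmf \<Rightarrow> real \<Rightarrow> bool" where
  "good_estimate D N \<longleftrightarrow>
     5 / 6 * real (card (set_pmf D)) \<le> N \<and> N \<le> 6 / 5 * real (card (set_pmf D))"

text \<open>
  The integral of a function that is not integrable is 0, so the bound in
  \<open>approximates_support\<close> entails that the integrand is measurable.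
\<close>

definition success_prob :: "det_alg measure \<Rightarrow> nat pmf \<Rightarrow> real" where
  "success_prob M D = (\<integral>A. measure_pmf.prob (run D A) {(N, t). good_estimate D N} \<partial>M)"

definition approximates_support :: "nat \<Rightarrow> det_alg measure \<Rightarrow> bool" where
  "approximates_support n M \<longleftrightarrow> (\<forall>D\<in>dists_on n. success_prob M D \<ge> 2 / 3)"

definition makes_at_most :: "nat \<Rightarrow> nat \<Rightarrow> det_alg measure \<Rightarrow> bool" where
  "makes_at_most q n M \<longleftrightarrow>
     (\<forall>D\<in>dists_on n. AE A in M. \<forall>(N, t)\<in>set_pmf (run D A). t \<le> q)"

end

theory Submission
  imports Defs
begin

text \<open>
  Put mass \<open>w\<close> close to 1 on the point 1 and spread the rest uniformly over a hidden set \<open>H\<close>,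
  either \<open>{i}\<close> or \<open>{i, i + 1}\<close>. The supports have sizes 2 and 3, and no estimate is good for both
  since \<open>3 / 2 > (6 / 5)\<^sup>2\<close>. As long as samples return 1 and no query meets \<open>H\<close>, all answers are
  determined by \<open>w\<close>. The at most \<open>q k\<close> points queried along this single path hit \<open>H\<close> for at most
  \<open>2 q k\<close> indices \<open>i\<close>, so averaging over \<open>i\<close> forces \<open>q k\<close> to be of order \<open>n\<close>.
\<close>

section \<open>Decision trees along the null path\<close>

definition null_answer :: "real \<Rightarrow> nat set \<Rightarrow> (nat \<times> real \<times> real) option" where
  "null_answer w S = (if 1 \<in> S then Some (1, w, 1) else None)"

text \<open>The path on which every sample is 1 and every query gets \<open>null_answer\<close>
  depends on \<open>w\<close> but not on the hidden set. It is therefore fixed before averaging over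
  hidden sets.\<close>

primrec null_output :: "real \<Rightarrow> det_alg \<Rightarrow> real" where
  "null_output w (Output N) = N"
| "null_output w (Samp f) = null_output w (f 1)"
| "null_output w (Cond_Eval S f) = null_output w (f (null_answer w S))"

primrec null_queries :: "real \<Rightarrow> det_alg \<Rightarrow> nat set list" where
  "null_queries w (Output N) = []"
| "null_queries w (Samp f) = null_queries w (f 1)"
| "null_queries w (Cond_Eval S f) = S # null_queries w (f (null_answer w S))"

lemma valid_queries_null_queries:
  "valid_queries n k A \<Longrightarrow> S \<in> set (null_queries w A) \<Longrightarrow> S \<subseteq> {1..n} \<and> card S \<le> k"
  by (induction A) auto

lemma card_Union_set_le:
  assumes "\<And>S. S \<in> set Ss \<Longrightarrow> card S \<le> k"
  shows "card (\<Union> (set Ss)) \<le> length Ss * k"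
  using assms
proof (induction Ss)
  case (Cons S Ss)
  have "card (\<Union> (set (S # Ss))) \<le> card S + card (\<Union> (set Ss))"
    by (simp add: card_Un_le)
  also have "\<dots> \<le> k + length Ss * k"
    using Cons by (intro add_mono) auto
  finally show ?case by simp
qed simp

text \<open>The cut by \<open>take q\<close> supplies the bound: the null path may be longer, since
  the query bound concerns only outcomes of positive probability.\<close>

lemma card_Union_take_null_queries_le:
  assumes "valid_queries n k A"
  shows "card (\<Union> (set (take q (null_queries w A)))) \<le> q * k"
proof -
  have "card (\<Union> (set (take q (null_queries w A)))) \<le> length (take q (null_queries w A)) * k"
    using valid_queries_null_queries[OF assms in_set_takeD] by (intro card_Union_set_le) blast
  also have "\<dots> \<le> q * k" by simp
  finally show ?thesis .
qed

lemma finite_Union_null_queries: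
  assumes "valid_queries n k A"
  shows "finite (\<Union> (set (take q (null_queries w A))))"
proof (intro finite_Union finite_set)
  fix S assume "S \<in> set (take q (null_queries w A))"
  then have "S \<subseteq> {1..n}"
    using valid_queries_null_queries[OF assms in_set_takeD] by blast
  then show "finite S" using finite_atLeastAtMost by (rule finite_subset)
qed

text \<open>Conditioning on \<open>S\<close> leaves only the point 1 if \<open>1 \<in> S\<close>;
  otherwise \<open>S\<close> has mass 0 and the oracle fails.\<close>

lemma cond_eval_oracle_eq_null_answer:
  assumes "1 \<in> set_pmf D" and "S \<inter> set_pmf D \<subseteq> {1}"
  shows "cond_eval_oracle D S = return_pmf (null_answer (pmf D 1) S)"
proof (cases "1 \<in> S")
  case True
  have prob: "measure_pmf.prob D S = pmf D 1"
  proof -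
    have "S \<inter> set_pmf D = {1}" using True assms by auto
    then show ?thesis
      by (metis measure_Int_set_pmf measure_pmf_single)
  qed
  have pos: "pmf D 1 > 0" using assms(1) by (simp add: pmf_positive)
  have "set_pmf D \<inter> S \<noteq> {}" using True assms by auto
  then have "set_pmf (cond_pmf D S) = {1}"
    using True assms by (auto simp: set_cond_pmf)
  then have "cond_pmf D S = return_pmf 1"
    by (simp flip: set_pmf_subset_singleton)
  then show ?thesis
    using True prob pos by (simp add: cond_eval_oracle_def null_answer_def)
next
  case False
  then have "S \<inter> set_pmf D = {}" using assms by auto
  then have "measure_pmf.prob D S = 0"
    by (metis measure_Int_set_pmf measure_empty)
  then show ?thesis using False by (simp add: cond_eval_oracle_def null_answer_def)
qed

text \<open>A query at the root would put an outcome with positive count into the support of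
  \<open>run D A\<close>, as supports are nonempty.\<close>

lemma run_0_queries:
  assumes "\<forall>(N, t)\<in>set_pmf (run D A). t \<le> 0"
  shows "\<exists>N. A = Output N"
proof (cases A)
  case (Samp f)
  obtain j where "j \<in> set_pmf D" using set_pmf_not_empty[of D] by blast
  moreover obtain x where "x \<in> set_pmf (run D (f j))" using set_pmf_not_empty[of "run D (f j)"] by blast
  ultimately have "apsnd Suc x \<in> set_pmf (run D A)" using Samp by auto
  with assms show ?thesis by (cases x) auto
next
  case (Cond_Eval S f)
  obtain j where "j \<in> set_pmf (cond_eval_oracle D S)"
    using set_pmf_not_empty[of "cond_eval_oracle D S"] by blast
  moreover obtain x where "x \<in> set_pmf (run D (f j))" using set_pmf_not_empty[of "run D (f j)"] by blast
  ultimately have "apsnd Suc x \<in> set_pmf (run D A)" using Cond_Eval by auto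
  with assms show ?thesis by (cases x) auto
qed simp

section \<open>Probability of the null output\<close>

lemma pmf_bind_ge:
  "pmf p x * pmf (f x) y \<le> pmf (bind_pmf p f) y"
proof -
  have "pmf p x * pmf (f x) y = (\<integral>z. indicator {x} z * pmf (f x) y \<partial>measure_pmf p)"
    by (simp add: measure_pmf_single)
  also have "\<dots> \<le> (\<integral>z. pmf (f z) y \<partial>measure_pmf p)"
    by (intro integral_mono measure_pmf.integrable_const_bound[where B = 1])
       (auto simp: pmf_le_1 indicator_def)
  finally show ?thesis by (simp add: pmf_bind)
qed

text \<open>Each sample stays on the null path with probability \<open>pmf D 1\<close>, each
  conditional query with certainty, and there are at most \<open>q\<close> of them.\<close>

lemma pmf_null_output_ge:
  assumes "1 \<in> set_pmf D"
    and "\<Union> (set (take q (null_queries (pmf D 1) A))) \<inter> set_pmf D \<subseteq> {1}"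
    and "\<forall>(N, t)\<in>set_pmf (run D A). t \<le> q"
  shows "pmf D 1 ^ q \<le> pmf (map_pmf fst (run D A)) (null_output (pmf D 1) A)"
  using assms(2,3)
proof (induction A arbitrary: q)
  case (Output N)
  then show ?case by (simp add: power_le_one pmf_le_1)
next
  case (Samp f)
  have "q \<noteq> 0" using run_0_queries[of D "Samp f"] Samp.prems(2) by (cases q) simp_all
  then obtain r where q: "q = Suc r" using not0_implies_Suc by blast
  \<comment> \<open>A sample uses up one unit of the budget without adding a set to the list, so the
    relevant prefix only shrinks.\<close>
  have "set (take r (null_queries (pmf D 1) (f 1))) \<subseteq> set (take q (null_queries (pmf D 1) (f 1)))"
    by (intro set_take_subset_set_take) (simp add: q)
  then have "\<Union> (set (take r (null_queries (pmf D 1) (f 1)))) \<inter> set_pmf D \<subseteq> {1}"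
    using Samp.prems(1) by fastforce
  moreover have "\<forall>(N, t)\<in>set_pmf (run D (f 1)). t \<le> r"
    using Samp.prems(2) assms(1) q by fastforce
  ultimately have "pmf D 1 ^ r
      \<le> pmf (map_pmf fst (run D (f 1))) (null_output (pmf D 1) (f 1))"
    by (intro Samp.IH) auto
  then have "pmf D 1 ^ q
      \<le> pmf D 1 * pmf (map_pmf fst (run D (f 1))) (null_output (pmf D 1) (f 1))"
    by (simp add: q mult_left_mono)
  also have "\<dots> \<le> pmf (bind_pmf D (\<lambda>j. map_pmf fst (run D (f j)))) (null_output (pmf D 1) (f 1))"
    by (rule pmf_bind_ge)
  finally show ?case by (simp add: map_bind_pmf pmf.map_comp o_def)
next
  case (Cond_Eval S f)
  let ?r = "null_answer (pmf D 1) S"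
  have "q \<noteq> 0"
    using run_0_queries[of D "Cond_Eval S f"] Cond_Eval.prems(2) by (cases q) simp_all
  then obtain r where q: "q = Suc r" using not0_implies_Suc by blast
  have answer: "cond_eval_oracle D S = return_pmf ?r"
    using Cond_Eval.prems(1) assms(1) q by (intro cond_eval_oracle_eq_null_answer) auto
  \<comment> \<open>The answer is deterministic, so this factor is given away.\<close>
  have "pmf D 1 ^ q \<le> pmf D 1 ^ r"
    by (simp add: q pmf_le_1 mult_left_le_one_le)
  also have "\<dots> \<le> pmf (map_pmf fst (run D (f ?r))) (null_output (pmf D 1) (f ?r))"
    using Cond_Eval.prems answer q by (intro Cond_Eval.IH) (auto simp: bind_return_pmf)
  finally show ?case
    by (simp add: answer bind_return_pmf pmf.map_comp o_def)
qed

abbreviation success :: "nat pmf \<Rightarrow> det_alg \<Rightarrow> real" where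
  "success D A \<equiv> measure_pmf.prob (run D A) {(N, t). good_estimate D N}"

lemma success_le:
  assumes "\<not> good_estimate D x"
  shows "success D A \<le> 1 - pmf (map_pmf fst (run D A)) x"
proof -
  have "pmf (map_pmf fst (run D A)) x = measure_pmf.prob (run D A) {y. fst y = x}"
    by (simp add: pmf_map vimage_def)
  moreover have "success D A + measure_pmf.prob (run D A) {y. fst y = x}
      = measure_pmf.prob (run D A) ({(N, t). good_estimate D N} \<union> {y. fst y = x})"
    using assms by (intro measure_pmf.finite_measure_Union[symmetric]) auto
  moreover have "\<dots> \<le> 1" by simp
  ultimately show ?thesis by linarith
qed

text \<open>Both runs produce the same null output with probability at least \<open>w ^ q\<close>,
  and it is wrong for one of them. That run succeeds with probability at most
  \<open>1 - w ^ q\<close>, the other with at most 1.\<close>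

lemma success_sum_le:
  assumes "\<not> (\<exists>N. good_estimate D N \<and> good_estimate D' N)"
    and "pmf D 1 = w" and "pmf D' 1 = w" and "w > 0"
    and "\<Union> (set (take q (null_queries w A))) \<inter> (set_pmf D \<union> set_pmf D') \<subseteq> {1}"
    and "\<forall>(N, t)\<in>set_pmf (run D A). t \<le> q"
    and "\<forall>(N, t)\<in>set_pmf (run D' A). t \<le> q"
  shows "success D A + success D' A \<le> 2 - w ^ q"
proof -
  let ?x = "null_output w A"
  have one: "1 \<in> set_pmf D" "1 \<in> set_pmf D'" using assms(2-4) by (auto simp: set_pmf_iff)
  have ge: "w ^ q \<le> pmf (map_pmf fst (run D A)) ?x" "w ^ q \<le> pmf (map_pmf fst (run D' A)) ?x"
    using pmf_null_output_ge[OF one(1), of q A] pmf_null_output_ge[OF one(2), of q A] assms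
    by auto
  have le1: "success D A \<le> 1" "success D' A \<le> 1" by simp_all
  consider "\<not> good_estimate D ?x" | "\<not> good_estimate D' ?x" using assms(1) by blast
  then show ?thesis
    by cases (use success_le[of D ?x A] success_le[of D' ?x A] ge le1 in linarith)+
qed

section \<open>Hidden sets and incompatible support sizes\<close>

definition hidden_pmf :: "real \<Rightarrow> nat set \<Rightarrow> nat pmf" where
  "hidden_pmf w H = bind_pmf (bernoulli_pmf w) (\<lambda>b. if b then return_pmf 1 else pmf_of_set H)"

lemma set_hidden_pmf:
  assumes "0 < w" "w < 1" "finite H" "H \<noteq> {}"
  shows "set_pmf (hidden_pmf w H) = insert 1 H"
  using assms by (auto simp: hidden_pmf_def set_pmf_bernoulli UNIV_bool)

lemma pmf_hidden_pmf_1: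
  assumes "0 < w" "w < 1" "finite H" "H \<noteq> {}" "1 \<notin> H"
  shows "pmf (hidden_pmf w H) 1 = w"
  using assms by (simp add: hidden_pmf_def pmf_bind)

text \<open>With support sizes \<open>s\<close> and \<open>s'\<close> the intervals of good
  estimates are disjoint once \<open>6 / 5 * s < 5 / 6 * s'\<close>.\<close>

lemma no_common_good_estimate:
  assumes "36 * card (set_pmf D) < 25 * card (set_pmf D')"
  shows "\<not> (\<exists>N. good_estimate D N \<and> good_estimate D' N)"
proof -
  have "36 * real (card (set_pmf D)) < 25 * real (card (set_pmf D'))"
    using assms by linarith
  then show ?thesis by (auto simp: good_estimate_def)
qed

section \<open>Averaging over the random seed and lower bounds\<close>

text \<open>Each of the 2 \<open>card I\<close> success probabilities is at least 2/3. Exchanging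
  sum and integral lets a bound for almost every deterministic algorithm limit their total.\<close>

lemma card_index_le_sum_success_bound:
  fixes D D' :: "'i \<Rightarrow> nat pmf"
  assumes "randomized_alg n k M" and "approximates_support n M" and "finite I"
    and "\<And>i. i \<in> I \<Longrightarrow> D i \<in> dists_on n" and "\<And>i. i \<in> I \<Longrightarrow> D' i \<in> dists_on n"
    and "AE A in M. (\<Sum>i\<in>I. success (D i) A + success (D' i) A) \<le> B"
  shows "4 / 3 * card I \<le> B"
proof -
  interpret prob_space M using assms(1) by (simp add: randomized_alg_def)
  have succ: "success_prob M E \<ge> 2 / 3" if "E \<in> dists_on n" for E
    using assms(2) that by (auto simp: approximates_support_def)
  \<comment> \<open>Without integrability the integral would take its default value 0, below
    2/3.\<close>
  have int: "integrable M (success E)" if "E \<in> dists_on n" for E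
  proof (rule ccontr)
    assume "\<not> integrable M (success E)"
    then have "success_prob M E = 0"
      by (simp add: success_prob_def not_integrable_integral_eq)
    with succ[OF that] show False by simp
  qed
  have "4 / 3 * card I = (\<Sum>i\<in>I. 2 / 3 + 2 / 3 :: real)" by simp
  also have "\<dots> \<le> (\<Sum>i\<in>I. success_prob M (D i) + success_prob M (D' i))"
    using assms(4,5) by (intro sum_mono add_mono succ)
  also have "\<dots> = (\<Sum>i\<in>I. \<integral>A. success (D i) A + success (D' i) A \<partial>M)"
    unfolding success_prob_def using assms(4,5) int by (intro sum.cong) auto
  also have "\<dots> = (\<integral>A. (\<Sum>i\<in>I. success (D i) A + success (D' i) A) \<partial>M)"
    using assms(4,5) int by (intro Bochner_Integration.integral_sum[symmetric]) auto
  also have "\<dots> \<le> (\<integral>A. B \<partial>M)"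
    using assms int by (intro integral_mono_AE) auto
  finally show ?thesis by (simp add: prob_space)
qed

text \<open>Covers small \<open>n\<close>, where \<open>n - 2\<close> gives no information. Without
  queries one fixed estimate would have to serve supports of sizes 1 and 2.\<close>

lemma queries_pos:
  assumes "2 \<le> n" and "randomized_alg n k M" and "approximates_support n M"
    and "makes_at_most q n M"
  shows "q > 0"
proof (rule ccontr)
  assume "\<not> q > 0"
  define D where "D = return_pmf (1 :: nat)"
  define D' where "D' = hidden_pmf (1 / 2) {2}"
  have set: "set_pmf D = {1}" "set_pmf D' = {1, 2}"
    by (simp_all add: D_def D'_def set_hidden_pmf)
  have dists: "D \<in> dists_on n" "D' \<in> dists_on n"
    using assms(1) set by (auto simp: dists_on_def)
  have no_common: "\<not> (\<exists>N. good_estimate D N \<and> good_estimate D' N)"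
    by (rule no_common_good_estimate) (simp add: set)
  have "AE A in M. \<forall>(N, t)\<in>set_pmf (run D A). t \<le> q"
    using assms(4) dists by (simp add: makes_at_most_def)
  then have "AE A in M. (\<Sum>i\<in>{()}. success D A + success D' A) \<le> 1"
  proof eventually_elim
    case (elim A)
    then obtain N where "A = Output N" using run_0_queries \<open>\<not> q > 0\<close> by blast
    with no_common show ?case by (auto simp: indicator_def)
  qed
  from card_index_le_sum_success_bound[OF assms(2,3) _ dists this] show False by simp
qed

lemma sum_le_card_exceptions:
  fixes f :: "'i \<Rightarrow> real"
  assumes "finite I" and "\<And>i. i \<in> I \<Longrightarrow> f i \<le> a + 1" and "\<And>i. i \<in> I - X \<Longrightarrow> f i \<le> a"
  shows "sum f I \<le> a * card I + card (I \<inter> X)"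
proof -
  have "sum f I \<le> (\<Sum>i\<in>I. a + indicator X i)"
    using assms by (intro sum_mono) (auto simp: indicator_def)
  also have "\<dots> = a * card I + card (I \<inter> X)"
    using assms(1) by (simp add: sum.distrib indicator_def of_bool_def sum.If_cases)
  finally show ?thesis .
qed

lemma queries_ge:
  assumes "2 \<le> n" and "randomized_alg n k M" and "approximates_support n M"
    and "makes_at_most q n M"
  shows "n - 2 \<le> 8 * (q * k)"
proof -
  \<comment> \<open>By Bernoulli's inequality this choice gives \<open>w ^ q\<close> at least 11/12,
    so a pair has total success at most 13/12, below the required 4/3. The \<open>+ 1\<close> keeps
    \<open>e\<close> meaningful for \<open>q = 0\<close>.\<close>
  define e :: real where "e = 1 / (12 * (real q + 1))"
  define w where "w = 1 - e"
  have e: "0 < e" "e < 1" "real q * e \<le> 1 / 12" by (auto simp: e_def field_simps)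
  then have w: "0 < w" "w < 1" by (auto simp: w_def)
  have "1 + real q * - e \<le> (1 + - e) ^ q"
    using e by (intro Bernoulli_inequality) simp
  with e(3) have w_pow: "2 - w ^ q \<le> 13 / 12" by (simp add: w_def)
  \<comment> \<open>Both \<open>i\<close> and \<open>i + 1\<close> must lie in
    \<open>{2..n}\<close>.\<close>
  define I where "I = {2..<n}"
  define D where "D = (\<lambda>i. hidden_pmf w {i})"
  define D' where "D' = (\<lambda>i. hidden_pmf w {i, i + 1})"
  have set: "set_pmf (D i) = {1, i}" "set_pmf (D' i) = {1, i, i + 1}" for i
    using w by (simp_all add: D_def D'_def set_hidden_pmf)
  have pmf: "pmf (D i) 1 = w" "pmf (D' i) 1 = w" if "i \<in> I" for i
    using w that unfolding D_def D'_def I_def by (intro pmf_hidden_pmf_1; simp)+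
  have dists: "D i \<in> dists_on n" "D' i \<in> dists_on n" if "i \<in> I" for i
    using that set by (auto simp: dists_on_def I_def)
  have no_common: "\<not> (\<exists>N. good_estimate (D i) N \<and> good_estimate (D' i) N)" if "i \<in> I" for i
    \<comment> \<open>The sizes are 2 and 3, and 36 * 2 < 25 * 3.\<close>
    using that by (intro no_common_good_estimate) (simp add: set I_def)
  have "AE A in M. \<forall>i\<in>I. \<forall>(N, t)\<in>set_pmf (run (D i) A). t \<le> q"
    "AE A in M. \<forall>i\<in>I. \<forall>(N, t)\<in>set_pmf (run (D' i) A). t \<le> q"
    using assms(4) dists by (auto intro!: AE_finite_allI simp: makes_at_most_def I_def)
  moreover have "AE A in M. valid_queries n k A"
    using assms(2) by (auto intro: AE_I2 simp: randomized_alg_def)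
  ultimately have "AE A in M. (\<Sum>i\<in>I. success (D i) A + success (D' i) A)
      \<le> 13 / 12 * card I + 2 * (q * k)"
  proof eventually_elim
    case (elim A)
    define U where "U = \<Union> (set (take q (null_queries w A)))"
    \<comment> \<open>The indices whose hidden set can be hit: \<open>i\<close> or
      \<open>i + 1\<close> lies in \<open>U\<close>.\<close>
    define X where "X = U \<union> (\<lambda>u. u - 1) ` U"
    have U: "finite U" "card U \<le> q * k"
      using finite_Union_null_queries card_Union_take_null_queries_le elim(3)
      by (auto simp: U_def)
    have "card (I \<inter> X) \<le> card X" using U(1) by (intro card_mono) (auto simp: X_def)
    also have "\<dots> \<le> card U + card U"
      unfolding X_def by (intro order.trans[OF card_Un_le] add_left_mono card_image_le U(1))
    finally have card_X: "card (I \<inter> X) \<le> 2 * (q * k)" using U(2) by simp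
    have "success (D i) A + success (D' i) A \<le> 13 / 12" if i: "i \<in> I - X" for i
    proof -
      have "i \<notin> U" "i + 1 \<notin> U" using i by (force simp: X_def)+
      then have "U \<inter> (set_pmf (D i) \<union> set_pmf (D' i)) \<subseteq> {1}" by (auto simp: set)
      then have "success (D i) A + success (D' i) A \<le> 2 - w ^ q"
        unfolding U_def using i elim pmf no_common w by (intro success_sum_le) auto
      with w_pow show ?thesis by simp
    qed
    moreover have "success (D i) A + success (D' i) A \<le> 13 / 12 + 1" for i
      using measure_pmf.prob_le_1[of "run (D i) A" "{(N, t). good_estimate (D i) N}"]
        measure_pmf.prob_le_1[of "run (D' i) A" "{(N, t). good_estimate (D' i) N}"] by linarith
    ultimately have "(\<Sum>i\<in>I. success (D i) A + success (D' i) A)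
        \<le> 13 / 12 * card I + card (I \<inter> X)"
      by (intro sum_le_card_exceptions) (auto simp: I_def)
    also have "\<dots> \<le> 13 / 12 * card I + 2 * (q * k)" using card_X by linarith
    finally show ?case .
  qed
  then have "4 / 3 * real (card I) \<le> 13 / 12 * card I + 2 * (q * k)"
    using dists by (intro card_index_le_sum_success_bound[OF assms(2,3)]) (auto simp: I_def)
  \<comment> \<open>The gap 4/3 - 13/12 = 1/4 turns 2 into 8.\<close>
  then have "real (card I) \<le> real (8 * (q * k))" by simp
  then show ?thesis unfolding of_nat_le_iff by (simp add: I_def)
qed

theorem theorem5p1:
  "\<exists>c::real. c > 0 \<and>
     (\<forall>n k q :: nat. \<forall>M :: det_alg measure.
        2 \<le> n \<longrightarrow> 1 \<le> k \<longrightarrow> k \<le> n \<longrightarrow>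
        randomized_alg n k M \<longrightarrow> approximates_support n M \<longrightarrow> makes_at_most q n M \<longrightarrow>
        c * (real n / real k) \<le> real q)"
proof (intro exI[of _ "1 / 24"] conjI allI impI)
  fix n k q :: nat and M :: "det_alg measure"
  assume n: "2 \<le> n" and k: "1 \<le> k"
    and M: "randomized_alg n k M" "approximates_support n M" "makes_at_most q n M"
  have "n - 2 \<le> 8 * (q * k)" using n M by (rule queries_ge)
  moreover have "q * k \<ge> 1" using queries_pos[OF n M] k by simp
  \<comment> \<open>As \<open>q * k\<close> is at least 1, it absorbs the 2 in \<open>n - 2\<close>;
    24 leaves slack.\<close>
  ultimately have "n \<le> 24 * (q * k)" using n by linarith
  then have "real n \<le> 24 * (real q * real k)"
    by (metis of_nat_le_iff of_nat_mult of_nat_numeral)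
  then show "1 / 24 * (real n / real k) \<le> real q" using k by (simp add: field_simps)
qed simp

end
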